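(* Let $G_{CP}$ be the $3$-uniform hypergraph on the $15$-element vertex set $X \cup Y \cup Z$, where $X = \{x_1, x_2, x_3\}$, $Y = \{y_1, \ldots, y_6\}$ and $Z = \{z_1, \ldots, z_6\}$, whose edge set consists of - $e_i = \{y_{2i-1}, y_{2i}, x_{i+1}\}$ for $i \in \{1,2,3\}$, where $x_4 = x_1$, - $f_i = \{x_{\lceil i/2 \rceil}, y_i, z_i\}$ for $i \in \{1, \ldots, 6\}$, and - $g = \{x_1, x_2, x_3\}$. Then Breaker wins (i.e. has a winning strategy for) the Maker-Breaker game on $G_{CP}$, where Maker goes first.
   Context: The Maker-Breaker game on a finite hypergraph $G$ is the following two-player perfect-information game. Maker and Breaker alternately take turns, each claiming one previously unclaimed vertex of $G$ per turn. If at any point Maker has claimed all of the vertices of some edge of $G$, Maker wins. If all of the vertices of $G$ have been claimed and Maker has not achieved this, Breaker wins. A player "wins" the game on $G$ if that player has a winning strategy. *)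

theory Defs
  imports Complex_Main
begin

type_synonym 'a hypergraph = "'a set \<times> 'a set set"

abbreviation vertices :: "'a hypergraph \<Rightarrow> 'a set" where
  "vertices \<equiv> fst"

abbreviation edges :: "'a hypergraph \<Rightarrow> 'a set set" where
  "edges \<equiv> snd"

definition finite_hypergraph :: "'a hypergraph \<Rightarrow> bool" where
  "finite_hypergraph G \<longleftrightarrow> finite (vertices G) \<and> (\<forall>e\<in>edges G. e \<subseteq> vertices G)"

definition uniform :: "nat \<Rightarrow> 'a hypergraph \<Rightarrow> bool" where
  "uniform k G \<longleftrightarrow> (\<forall>e\<in>edges G. card e = k)"


datatype player = Maker | Breaker

fun opponent :: "player \<Rightarrow> player" where
  "opponent Maker = Breaker"
| "opponent Breaker = Maker"

text \<open>
  A history is the list of the vertices claimed so far, in chronological order. In the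
  functions below, the argument \<open>first\<close> is the player who makes the move number 0.
\<close>

definition turn :: "player \<Rightarrow> nat \<Rightarrow> player" where
  "turn first n = (if even n then first else opponent first)"

definition claimed :: "player \<Rightarrow> player \<Rightarrow> 'a list \<Rightarrow> 'a set" where
  "claimed first p h = {h ! n | n. n < length h \<and> turn first n = p}"

definition maker_won :: "'a hypergraph \<Rightarrow> player \<Rightarrow> 'a list \<Rightarrow> bool" where
  "maker_won G first h \<longleftrightarrow> (\<exists>e\<in>edges G. e \<subseteq> claimed first Maker h)"

text \<open>The last conjunct says that play does not continue once Maker has completed an edge.\<close>

definition position :: "'a hypergraph \<Rightarrow> player \<Rightarrow> 'a list \<Rightarrow> bool" where
  "position G first h \<longleftrightarrow>
     distinct h \<and> set h \<subseteq> vertices G \<and> (\<forall>n<length h. \<not> maker_won G first (take n h))"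

definition game_over :: "'a hypergraph \<Rightarrow> player \<Rightarrow> 'a list \<Rightarrow> bool" where
  "game_over G first h \<longleftrightarrow> maker_won G first h \<or> set h = vertices G"

definition winner :: "'a hypergraph \<Rightarrow> player \<Rightarrow> 'a list \<Rightarrow> player" where
  "winner G first h = (if maker_won G first h then Maker else Breaker)"

type_synonym 'a strategy = "'a list \<Rightarrow> 'a"

text \<open>
  The values of a strategy for \<open>p\<close> matter only at unfinished positions in which it is the
  turn of \<open>p\<close>; there it has to choose an unclaimed vertex.
\<close>

definition legal_strategy :: "'a hypergraph \<Rightarrow> player \<Rightarrow> player \<Rightarrow> 'a strategy \<Rightarrow> bool" where
  "legal_strategy G first p s \<longleftrightarrow>
     (\<forall>h. position G first h \<and> \<not> game_over G first h \<and> turn first (length h) = p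
        \<longrightarrow> s h \<in> vertices G - set h)"

definition follows :: "player \<Rightarrow> player \<Rightarrow> 'a strategy \<Rightarrow> 'a list \<Rightarrow> bool" where
  "follows first p s h \<longleftrightarrow> (\<forall>n<length h. turn first n = p \<longrightarrow> h ! n = s (take n h))"

definition winning_strategy :: "'a hypergraph \<Rightarrow> player \<Rightarrow> player \<Rightarrow> 'a strategy \<Rightarrow> bool" where
  "winning_strategy G first p s \<longleftrightarrow>
     legal_strategy G first p s \<and>
     (\<forall>h. position G first h \<and> game_over G first h \<and> follows first p s h
        \<longrightarrow> winner G first h = p)"

definition wins :: "player \<Rightarrow> 'a hypergraph \<Rightarrow> player \<Rightarrow> bool" where
  "wins p G first \<longleftrightarrow> (\<exists>s. winning_strategy G first p s)"


datatype vertex = vx nat | vy nat | vz nat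

definition e_CP :: "nat \<Rightarrow> vertex set" where
  "e_CP i = {vy (2 * i - 1), vy (2 * i), vx (if i = 3 then 1 else i + 1)}"

definition f_CP :: "nat \<Rightarrow> vertex set" where
  "f_CP i = {vx (nat \<lceil>real i / 2\<rceil>), vy i, vz i}"

definition g_CP :: "vertex set" where
  "g_CP = {vx 1, vx 2, vx 3}"

definition G_CP :: "vertex hypergraph" where
  "G_CP = (vx ` {1..3} \<union> vy ` {1..6} \<union> vz ` {1..6},
           e_CP ` {1..3} \<union> f_CP ` {1..6} \<union> {g_CP})"

lemma card_vertices_G_CP: "card (vertices G_CP) = 15"
proof -
  have "card (vx ` {1..3}) = 3" "card (vy ` {1..6}) = 6" "card (vz ` {1..6}) = 6"
    by (simp_all add: card_image inj_on_def)
  moreover have "card (vx ` {1..3} \<union> vy ` {1..6} \<union> vz ` {1..6}) =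
      card (vx ` {1..3}) + card (vy ` {1..6}) + card (vz ` {1..6})"
    by (subst card_Un_disjoint; auto)+
  ultimately show ?thesis
    by (simp add: G_CP_def)
qed

lemma nat_atLeastAtMost_unfold: "{1..3::nat} = {1, 2, 3}" "{1..6::nat} = {1, 2, 3, 4, 5, 6}"
  by auto

lemma edges_G_CP:
  "edges G_CP =
    {{vy 1, vy 2, vx 2}, {vy 3, vy 4, vx 3}, {vy 5, vy 6, vx 1},
     {vx 1, vy 1, vz 1}, {vx 1, vy 2, vz 2}, {vx 2, vy 3, vz 3}, {vx 2, vy 4, vz 4},
     {vx 3, vy 5, vz 5}, {vx 3, vy 6, vz 6}, {vx 1, vx 2, vx 3}}"
proof -
  have "\<lceil>1 / 2 :: real\<rceil> = 1" "\<lceil>3 / 2 :: real\<rceil> = 2" "\<lceil>5 / 2 :: real\<rceil> = 3"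
    by linarith+
  then show ?thesis
    unfolding G_CP_def nat_atLeastAtMost_unfold
    by (simp add: e_CP_def f_CP_def g_CP_def insert_commute flip: numeral_2_eq_2)
qed

lemma finite_hypergraph_G_CP: "finite_hypergraph G_CP"
  unfolding finite_hypergraph_def edges_G_CP by (auto simp: G_CP_def)

lemma uniform_G_CP: "uniform 3 G_CP"
  unfolding uniform_def edges_G_CP by simp

end

theory Submission
  imports Defs
begin

text \<open>
  Breaker answers \<open>x\<^sub>1\<close> and \<open>y\<^sub>1\<close> by \<open>x\<^sub>2\<close>, and \<open>z\<^sub>1\<close> by \<open>x\<^sub>1\<close>; all other first moves of Maker are
  equivalent to one of these under the symmetries of the hypergraph. Delete the edges hit by
  Breaker, delete Maker's vertices from the remaining edges, and replace some edges by subsets.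
  What is left splits into vertex-disjoint parts, each of which is a single edge with two
  vertices or one of two small hypergraphs. Breaker wins as second player on each
  part, and therefore on their union by always answering in the part where Maker has just played.
\<close>

section \<open>Breaker's win as a coinductive property of edge sets\<close>

definition residual :: "'a \<Rightarrow> 'a \<Rightarrow> 'a set set \<Rightarrow> 'a set set" where
  "residual v w E = {e \<in> (\<lambda>e. e - {v}) ` E. w \<notin> e}"

text \<open>
  Maker is to move. The moves need not be legal: the reply \<open>w = v\<close> is a pass, since \<open>v\<close> lies in no
  residual edge.
\<close>

coinductive breaker_holds :: "'a set set \<Rightarrow> bool" where
  "{} \<notin> E \<Longrightarrow> \<forall>v. \<exists>w. breaker_holds (residual v w E) \<Longrightarrow> breaker_holds E"

lemma breaker_holds_no_empty: "breaker_holds E \<Longrightarrow> {} \<notin> E"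
  by (auto elim: breaker_holds.cases)

lemma breaker_holds_reply: "breaker_holds E \<Longrightarrow> \<exists>w. breaker_holds (residual v w E)"
  by (auto elim: breaker_holds.cases)

lemma residual_notin_Union: "v \<notin> \<Union>E \<Longrightarrow> residual v v E = E"
  by (force simp: residual_def image_iff)

text \<open>A Maker move outside \<open>\<Union>E\<close> is answered by a pass, which reproduces
  \<open>E\<close>. The claim for \<open>E\<close> then refers back to itself, as coinduction
  permits, so only moves inside \<open>\<Union>E\<close> need a reply.\<close>

lemma breaker_holdsI:
  assumes "{} \<notin> E" "\<And>v. v \<in> \<Union>E \<Longrightarrow> \<exists>w. breaker_holds (residual v w E)"
  shows "breaker_holds E"
proof (rule breaker_holds.intros)
  show "\<forall>v. \<exists>w. breaker_holds (residual v w E)"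
  proof
    fix v
    show "\<exists>w. breaker_holds (residual v w E)"
    proof (cases "v \<in> \<Union>E")
      case False
      have "breaker_holds E"
      proof (coinduction rule: breaker_holds.coinduct)
        case breaker_holds
        show ?case
          using assms residual_notin_Union[of _ E] by (metis (no_types, lifting))
      qed
      then show ?thesis
        using False residual_notin_Union[of v E] by metis
    qed (rule assms(2))
  qed
qed (rule assms(1))

text \<open>Breaker replies as on \<open>F\<close>. If \<open>f \<subseteq> e\<close> and the reply
  misses what Maker's move leaves of \<open>e\<close>, it also misses what is left of
  \<open>f\<close>, so the domination survives every round.\<close>

lemma breaker_holds_mono:
  assumes "breaker_holds F" "\<forall>e\<in>E. \<exists>f\<in>F. f \<subseteq> e"
  shows "breaker_holds E"
  using assms
proof (coinduction arbitrary: E F rule: breaker_holds.coinduct)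
  case breaker_holds
  have "\<exists>w F'. breaker_holds F' \<and> (\<forall>e\<in>residual v w E. \<exists>f\<in>F'. f \<subseteq> e)" for v
  proof -
    obtain w where w: "breaker_holds (residual v w F)"
      using breaker_holds_reply[OF breaker_holds(1)] by blast
    moreover have "\<forall>e\<in>residual v w E. \<exists>f\<in>residual v w F. f \<subseteq> e"
    proof
      fix e assume "e \<in> residual v w E"
      then obtain e' where e': "e' \<in> E" "e = e' - {v}" "w \<notin> e"
        by (auto simp: residual_def)
      then obtain f where "f \<in> F" "f \<subseteq> e'"
        using breaker_holds(2) by blast
      then have "f - {v} \<in> residual v w F" "f - {v} \<subseteq> e"
        using e' by (auto simp: residual_def)
      then show "\<exists>f\<in>residual v w F. f \<subseteq> e" by blast
    qed
    ultimately show ?thesis by blast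
  qed
  moreover have "{} \<notin> E"
    using breaker_holds(2) breaker_holds_no_empty[OF breaker_holds(1)] by fastforce
  ultimately show ?case by (intro exI[of _ E] conjI refl allI) meson+
qed

text \<open>Only an inclusion, since \<open>w\<close> may also hit edges of
  \<open>F\<close>.\<close>

lemma residual_Un_subset: "v \<notin> \<Union>F \<Longrightarrow> residual v w (E \<union> F) \<subseteq> residual v w E \<union> F"
  by (force simp: residual_def)

lemma Union_residual_subset: "\<Union>(residual v w E) \<subseteq> \<Union>E"
  by (auto simp: residual_def)

lemma breaker_holds_Un:
  assumes "breaker_holds E" "breaker_holds F" "\<Union>E \<inter> \<Union>F = {}"
  shows "breaker_holds (E \<union> F)"
proof -
  \<comment> \<open>Replies may delete edges of the other part as well, so the coinduction invariant
    has to allow every subset of the union.\<close>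
  have "breaker_holds D" if "D \<subseteq> E \<union> F" for D
    using assms that
  proof (coinduction arbitrary: D E F rule: breaker_holds.coinduct)
    case breaker_holds
    have "\<exists>w E' F'. breaker_holds E' \<and> breaker_holds F' \<and> \<Union>E' \<inter> \<Union>F' = {} \<and>
            residual v w D \<subseteq> E' \<union> F'" for v
    proof -
      have *: "\<exists>w E'. breaker_holds E' \<and> \<Union>E' \<inter> \<Union>B = {} \<and> residual v w D \<subseteq> E' \<union> B"
        if "breaker_holds A" "\<Union>A \<inter> \<Union>B = {}" "D \<subseteq> A \<union> B" "v \<notin> \<Union>B" for A B
      proof -
        obtain w where "breaker_holds (residual v w A)"
          using breaker_holds_reply[OF \<open>breaker_holds A\<close>] by blast
        moreover have "residual v w D \<subseteq> residual v w A \<union> B"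
          using that(3) residual_Un_subset[OF that(4), of w A] by (auto simp: residual_def)
        ultimately show ?thesis
          using that(2) Union_residual_subset[of v w A] by blast
      qed
      consider "v \<notin> \<Union>F" | "v \<notin> \<Union>E"
        using breaker_holds by blast
      then show ?thesis
      proof cases
        case 1
        then show ?thesis using *[of E F] breaker_holds by blast
      next
        case 2
        then show ?thesis
          using *[of F E] breaker_holds by (simp add: Un_commute Int_commute) blast
      qed
    qed
    moreover have "{} \<notin> D"
      using breaker_holds breaker_holds_no_empty by blast
    ultimately show ?case by (intro exI[of _ D] conjI refl allI) meson+
  qed
  then show ?thesis by blast
qed

section \<open>Small hypergraphs on which Breaker holds as second player\<close>

lemma breaker_holds_empty: "breaker_holds {}"
  by (rule breaker_holdsI) auto

lemma breaker_holds_pair: "a \<noteq> b \<Longrightarrow> breaker_holds {{a, b}}"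
proof (rule breaker_holdsI)
  fix v assume "a \<noteq> b" "v \<in> \<Union>{{a, b}}"
  then have "residual v (if v = a then b else a) {{a, b}} = {}"
    by (auto simp: residual_def)
  then show "\<exists>w. breaker_holds (residual v w {{a, b}})"
    using breaker_holds_empty by metis
qed simp

lemma breaker_holds_insert_pair:
  "breaker_holds E \<Longrightarrow> a \<noteq> b \<Longrightarrow> a \<notin> \<Union>E \<Longrightarrow> b \<notin> \<Union>E \<Longrightarrow> breaker_holds (insert {a, b} E)"
  using breaker_holds_Un[OF breaker_holds_pair, of a b E] by auto

lemma breaker_holds_replyI:
  assumes "breaker_holds F" "\<forall>e\<in>E. w \<in> e - {v} \<or> (\<exists>f\<in>F. f \<subseteq> e - {v})"
  shows "\<exists>w. breaker_holds (residual v w E)"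
  using assms by (intro exI[of _ w] breaker_holds_mono[OF assms(1)]) (auto simp: residual_def)

text \<open>Each of \<open>a\<close> and \<open>b\<close> hits two of the three edges. Breaker takes
  \<open>b\<close> against \<open>a\<close> or \<open>e\<close>, and \<open>a\<close> otherwise; the
  one edge left then still contains a pair of unclaimed vertices.\<close>

lemma breaker_holds_gadget3:
  assumes "distinct [a, b, c, d, e]"
  shows "breaker_holds {{a, b}, {c, a, d}, {c, b, e}}" (is "breaker_holds ?E")
proof (rule breaker_holdsI)
  fix v assume "v \<in> \<Union>?E"
  then consider "v \<in> {c, d}" | "v = a" | "v \<in> {b, e}"
    by auto
  then show "\<exists>w. breaker_holds (residual v w ?E)"
  proof cases
    case 1
    have "breaker_holds {{b, if v = c then e else c}}"
      using assms by (intro breaker_holds_pair) auto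
    then show ?thesis
      by (rule breaker_holds_replyI[where w = a]) (use 1 assms in auto)
  next
    case 2
    have "breaker_holds {{c, d}}"
      using assms by (intro breaker_holds_pair) auto
    then show ?thesis
      by (rule breaker_holds_replyI[where w = b]) (use 2 assms in auto)
  next
    case 3
    have "breaker_holds {{c, if v = b then e else a}}"
      using assms by (intro breaker_holds_pair) auto
    then show ?thesis
      by (rule breaker_holds_replyI[where w = "if v = b then a else b"]) (use 3 assms in auto)
  qed
qed simp

text \<open>If Maker takes \<open>x\<close>, the forced reply \<open>z\<close> leaves the three-edge
  gadget. Otherwise Breaker takes \<open>x\<close>, and the two remaining edges, which share only
  \<open>c\<close>, contain disjoint unclaimed pairs.\<close>

lemma breaker_holds_gadget4:
  assumes "distinct [x, z, a, b, c, d, e]"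
  shows "breaker_holds {{x, z}, {x, a, b}, {c, a, d}, {c, b, e}}" (is "breaker_holds ?E")
proof (rule breaker_holdsI)
  fix v assume "v \<in> \<Union>?E"
  then consider "v = x" | "v \<in> {z, c}" | "v \<in> {a, d}" | "v \<in> {b, e}"
    by auto
  then show "\<exists>w. breaker_holds (residual v w ?E)"
  proof cases
    case 1
    have "breaker_holds {{a, b}, {c, a, d}, {c, b, e}}"
      using assms by (intro breaker_holds_gadget3) auto
    then show ?thesis
      by (rule breaker_holds_replyI[where w = z]) (use 1 assms in auto)
  next
    case 2
    have "breaker_holds {{a, d}, {b, e}}"
      using assms by (intro breaker_holds_insert_pair breaker_holds_empty) auto
    then show ?thesis
      by (rule breaker_holds_replyI[where w = x]) (use 2 assms in auto)
  next
    case 3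
    have "breaker_holds {{c, if v = a then d else a}, {b, e}}"
      using assms by (intro breaker_holds_insert_pair breaker_holds_empty) auto
    then show ?thesis
      by (rule breaker_holds_replyI[where w = x]) (use 3 assms in auto)
  next
    case 4
    have "breaker_holds {{c, if v = b then e else b}, {a, d}}"
      using assms by (intro breaker_holds_insert_pair breaker_holds_empty) auto
    then show ?thesis
      by (rule breaker_holds_replyI[where w = x]) (use 4 assms in auto)
  qed
qed simp

section \<open>Breaker's first reply on \<open>G_CP\<close>\<close>

text \<open>The vertices are variables so that each symmetry of the hypergraph becomes an
  instantiation.\<close>

lemma breaker_reply_CP:
  assumes dist: "distinct [x1, x2, x3, y1, y2, y3, y4, y5, y6, z1, z2, z3, z4, z5, z6]"
    and E: "E = {{y1, y2, x2}, {y3, y4, x3}, {y5, y6, x1}, {x1, y1, z1}, {x1, y2, z2},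
      {x2, y3, z3}, {x2, y4, z4}, {x3, y5, z5}, {x3, y6, z6}, {x1, x2, x3}}"
    and v: "v \<in> {x1, y1, z1}"
  shows "\<exists>w. breaker_holds (residual v w E)"
proof -
  consider "v = x1" | "v = y1" | "v = z1"
    using v by blast
  then show ?thesis
  proof cases
    case 1
    \<comment> \<open>Dropping \<open>x3\<close> from \<open>{y3, y4, x3}\<close> separates that
      edge from the gadget formed by the last three edges.\<close>
    have "breaker_holds {{y1, z1}, {y2, z2}, {y3, y4}, {y5, y6}, {x3, y5, z5}, {x3, y6, z6}}"
      using dist by (intro breaker_holds_insert_pair[of _ y1] breaker_holds_insert_pair[of _ y2]
          breaker_holds_insert_pair[of _ y3] breaker_holds_gadget3) auto
    then show ?thesis
      by (rule breaker_holds_replyI[where w = x2]) (use 1 dist in \<open>auto simp: E\<close>)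
  next
    case 2
    \<comment> \<open>Here \<open>x3\<close> is dropped from \<open>{y3, y4, x3}\<close> and
      \<open>x1\<close> from \<open>{x1, y2, z2}\<close>; the last four edges form the
      gadget.\<close>
    have "breaker_holds {{y2, z2}, {y3, y4}, {x1, z1}, {x1, y5, y6}, {x3, y5, z5}, {x3, y6, z6}}"
      using dist by (intro breaker_holds_insert_pair[of _ y2] breaker_holds_insert_pair[of _ y3]
          breaker_holds_gadget4) auto
    then show ?thesis
      by (rule breaker_holds_replyI[where w = x2]) (use 2 dist in \<open>auto simp: E\<close>)
  next
    case 3
    \<comment> \<open>A pairing: each of the six surviving edges contains its own pair, and the
      pairs are disjoint.\<close>
    have "breaker_holds {{y1, y2}, {x2, z3}, {y4, z4}, {x3, y3}, {y5, z5}, {y6, z6}}"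
      using dist by (intro breaker_holds_insert_pair breaker_holds_empty) auto
    then show ?thesis
      by (rule breaker_holds_replyI[where w = x1]) (use 3 dist in \<open>auto simp: E\<close>)
  qed
qed

text \<open>The six edges \<open>f_CP i\<close> cover all vertices. Cyclic rotation of the three
  indices of the \<open>vx\<close>, combined with exchanging the two \<open>vy\<close> and the two
  \<open>vz\<close> attached to one \<open>vx\<close>, carries each of them to
  \<open>f_CP 1\<close>.\<close>

lemma breaker_holds_G_CP: "breaker_holds (edges G_CP)"
proof (rule breaker_holdsI)
  fix v assume "v \<in> \<Union>(edges G_CP)"
  then consider
      "v \<in> {vx 1, vy 1, vz 1}" | "v \<in> {vx 1, vy 2, vz 2}"
    | "v \<in> {vx 2, vy 3, vz 3}" | "v \<in> {vx 2, vy 4, vz 4}"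
    | "v \<in> {vx 3, vy 5, vz 5}" | "v \<in> {vx 3, vy 6, vz 6}"
    unfolding edges_G_CP by blast
  then show "\<exists>w. breaker_holds (residual v w (edges G_CP))"
  proof cases
    case 1
    then show ?thesis
      by (rule breaker_reply_CP[of "vx 1" "vx 2" "vx 3" "vy 1" "vy 2" "vy 3" "vy 4" "vy 5" "vy 6"
            "vz 1" "vz 2" "vz 3" "vz 4" "vz 5" "vz 6", rotated -1])
        (simp, unfold edges_G_CP, simp only: insert_commute)
  next
    case 2
    then show ?thesis
      by (rule breaker_reply_CP[of "vx 1" "vx 2" "vx 3" "vy 2" "vy 1" "vy 3" "vy 4" "vy 5" "vy 6"
            "vz 2" "vz 1" "vz 3" "vz 4" "vz 5" "vz 6", rotated -1])
        (simp, unfold edges_G_CP, simp only: insert_commute)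
  next
    case 3
    then show ?thesis
      by (rule breaker_reply_CP[of "vx 2" "vx 3" "vx 1" "vy 3" "vy 4" "vy 5" "vy 6" "vy 1" "vy 2"
            "vz 3" "vz 4" "vz 5" "vz 6" "vz 1" "vz 2", rotated -1])
        (simp, unfold edges_G_CP, simp only: insert_commute)
  next
    case 4
    then show ?thesis
      by (rule breaker_reply_CP[of "vx 2" "vx 3" "vx 1" "vy 4" "vy 3" "vy 5" "vy 6" "vy 1" "vy 2"
            "vz 4" "vz 3" "vz 5" "vz 6" "vz 1" "vz 2", rotated -1])
        (simp, unfold edges_G_CP, simp only: insert_commute)
  next
    case 5
    then show ?thesis
      by (rule breaker_reply_CP[of "vx 3" "vx 1" "vx 2" "vy 5" "vy 6" "vy 1" "vy 2" "vy 3" "vy 4"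
            "vz 5" "vz 6" "vz 1" "vz 2" "vz 3" "vz 4", rotated -1])
        (simp, unfold edges_G_CP, simp only: insert_commute)
  next
    case 6
    then show ?thesis
      by (rule breaker_reply_CP[of "vx 3" "vx 1" "vx 2" "vy 6" "vy 5" "vy 1" "vy 2" "vy 3" "vy 4"
            "vz 6" "vz 5" "vz 1" "vz 2" "vz 3" "vz 4", rotated -1])
        (simp, unfold edges_G_CP, simp only: insert_commute)
  qed
qed (simp add: edges_G_CP)

section \<open>From edge sets to strategies on histories\<close>

text \<open>The bridge to \<open>breaker_holds\<close>: a legal round \<open>v\<close>,
  \<open>w\<close> with Maker moving first changes this set exactly by
  \<open>residual v w\<close>.\<close>

definition live_edges :: "'a hypergraph \<Rightarrow> 'a list \<Rightarrow> 'a set set" where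
  "live_edges G h =
     (\<lambda>e. e - claimed Maker Maker h) ` {e \<in> edges G. e \<inter> claimed Maker Breaker h = {}}"

lemma turn_Maker: "turn Maker n = Maker \<longleftrightarrow> even n" "turn Maker n = Breaker \<longleftrightarrow> odd n"
  by (simp_all add: turn_def)

lemma claimed_Nil: "claimed first p [] = {}"
  by (simp add: claimed_def)

lemma claimed_snoc:
  "claimed first p (h @ [v]) =
     (if turn first (length h) = p then insert v (claimed first p h) else claimed first p h)"
proof -
  have claimed_image: "claimed first p g = (!) g ` {n. n < length g \<and> turn first n = p}"
    for g :: "'a list"
    by (auto simp: claimed_def)
  have "{n. n < length (h @ [v]) \<and> turn first n = p} =
      (if turn first (length h) = p then {length h} else {}) \<union>
      {n. n < length h \<and> turn first n = p}"
    by (auto simp: less_Suc_eq)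
  moreover have "(!) (h @ [v]) ` {n. n < length h \<and> turn first n = p} = claimed first p h"
    unfolding claimed_image by (intro image_cong) (auto simp: nth_append)
  ultimately show ?thesis
    unfolding claimed_image[of "h @ [v]"] by (simp add: image_Un)
qed

lemma set_eq_claimed: "set h = claimed first Maker h \<union> claimed first Breaker h"
  by (auto simp: claimed_def in_set_conv_nth) (metis player.exhaust)

lemma claimed_disjoint:
  "distinct h \<Longrightarrow> claimed first Maker h \<inter> claimed first Breaker h = {}"
  by (auto simp: claimed_def nth_eq_iff_index_eq)

lemma maker_won_live_edges:
  assumes "distinct h" "maker_won G Maker h"
  shows "{} \<in> live_edges G h"
proof -
  obtain e where e: "e \<in> edges G" "e \<subseteq> claimed Maker Maker h"
    using assms(2) by (auto simp: maker_won_def)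
  then have "e \<inter> claimed Maker Breaker h = {}" "e - claimed Maker Maker h = {}"
    using claimed_disjoint[OF assms(1), of Maker] by blast+
  then show ?thesis
    using e(1) unfolding live_edges_def by (intro image_eqI[of _ _ e]) simp_all
qed

lemma live_edges_snoc_Maker:
  "even (length h) \<Longrightarrow> live_edges G (h @ [v]) = (\<lambda>e. e - {v}) ` live_edges G h"
  by (simp add: live_edges_def claimed_snoc turn_Maker image_image Diff_insert[of _ v "claimed Maker Maker h"])

text \<open>Freshness of \<open>w\<close> matters: live edges have lost Maker's vertices, so looking
  for \<open>w\<close> in them agrees with looking in the original edges only if Maker does not own
  \<open>w\<close>.\<close>

lemma live_edges_snoc_Breaker:
  assumes "odd (length h)" "w \<notin> set h"
  shows "live_edges G (h @ [w]) = {e \<in> live_edges G h. w \<notin> e}"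
  using assms by (auto simp: live_edges_def claimed_snoc turn_Maker set_eq_claimed[of h Maker])

lemma live_edges_disjoint: "e \<in> live_edges G h \<Longrightarrow> e \<inter> set h = {}"
  unfolding live_edges_def set_eq_claimed[of h Maker] by blast

text \<open>The abstract reply \<open>w0\<close> may be illegal. It then lies in no live edge, so
  any free vertex serves at least as well, by monotonicity.\<close>

lemma breaker_holds_legal_reply:
  assumes "\<forall>e\<in>edges G. e \<subseteq> vertices G" "breaker_holds (live_edges G h)"
    and "even (length h)" "\<not> vertices G \<subseteq> set (h @ [v])"
  shows "\<exists>w \<in> vertices G - set (h @ [v]). breaker_holds (live_edges G (h @ [v, w]))"
proof -
  obtain w0 where w0: "breaker_holds (residual v w0 (live_edges G h))"
    using breaker_holds_reply[OF assms(2)] by blast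
  obtain w where w: "w \<in> vertices G - set (h @ [v])"
    and w_eq: "w0 \<in> vertices G - set (h @ [v]) \<Longrightarrow> w = w0"
    using assms(4) by blast
  have *: "live_edges G (h @ [v, w]) = {e \<in> live_edges G (h @ [v]). w \<notin> e}"
    using live_edges_snoc_Breaker[of "h @ [v]" w G] w assms(3) by simp
  have "e \<in> residual v w0 (live_edges G h)" if "e \<in> live_edges G (h @ [v, w])" for e
  proof -
    have e: "e \<in> live_edges G (h @ [v])" "w \<notin> e"
      using that * by auto
    have "e \<subseteq> vertices G"
      using e(1) assms(1) unfolding live_edges_def by blast
    moreover have "e \<inter> set (h @ [v]) = {}"
      by (rule live_edges_disjoint[OF e(1)])
    ultimately have "w0 \<notin> e"
      using e(2) w_eq by blast
    then show ?thesis
      using e(1) live_edges_snoc_Maker[OF assms(3), of G v] by (simp add: residual_def)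
  qed
  then have "breaker_holds (live_edges G (h @ [v, w]))"
    by (intro breaker_holds_mono[OF w0]) blast
  then show ?thesis
    using w by blast
qed

lemma follows_snoc:
  "follows first p s (h @ [v]) \<longleftrightarrow>
     follows first p s h \<and> (turn first (length h) = p \<longrightarrow> v = s h)"
proof -
  have "(h @ [v]) ! n = s (take n (h @ [v])) \<longleftrightarrow> h ! n = s (take n h)" if "n < length h" for n
    using that by (simp add: nth_append)
  then show ?thesis
    unfolding follows_def length_append_singleton All_less_Suc by auto
qed

theorem breaker_holds_imp_wins:
  assumes sub: "\<forall>e\<in>edges G. e \<subseteq> vertices G" and E: "breaker_holds (edges G)"
  shows "wins Breaker G Maker"
proof -
  define good where
    "good h w \<longleftrightarrow> w \<in> vertices G - set h \<and> breaker_holds (live_edges G (h @ [w]))" for h w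
  \<comment> \<open>The fallback secures legality at positions that do not arise when Breaker
    follows \<open>s\<close>.\<close>
  define s where "s h = (if \<exists>w. good h w then SOME w. good h w
    else SOME w. w \<in> vertices G - set h)" for h
  have good_s: "good h (s h)" if "\<exists>w. good h w" for h
    unfolding s_def[of h] if_P[OF that] by (rule someI_ex[OF that])
  have s_legal: "s h \<in> vertices G - set h" if "\<exists>w. w \<in> vertices G - set h" for h
  proof (cases "\<exists>w. good h w")
    case True
    then show ?thesis using good_s good_def by blast
  next
    case False
    show ?thesis
      unfolding s_def[of h] if_not_P[OF False] by (rule someI_ex[OF that])
  qed
  have even_holds: "breaker_holds (live_edges G h)"
    if "even (length h)" "distinct h" "set h \<subseteq> vertices G" "follows Maker Breaker s h" for h
    using that
  \<comment> \<open>The invariant concerns Maker's turns only, so the induction removes a whole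
    round of two moves.\<close>
  proof (induction "length h" arbitrary: h rule: less_induct)
    case less
    show ?case
    proof (cases h rule: rev_cases)
      case Nil
      then show ?thesis using E by (simp add: live_edges_def claimed_Nil)
    next
      case (snoc h1 w)
      then obtain h' v where h1: "h1 = h' @ [v]"
        using less.prems(1) by (cases h1 rule: rev_cases) auto
      have h': "even (length h')" "distinct h'" "set h' \<subseteq> vertices G" "follows Maker Breaker s h'"
        and w: "w \<in> vertices G" "w \<notin> set h1" "w = s h1"
        using less.prems unfolding snoc h1 by (auto simp: follows_snoc turn_Maker simp del: append_assoc)
      have "breaker_holds (live_edges G h')"
        using less.hyps[OF _ h'] unfolding snoc h1 by simp
      \<comment> \<open>The move \<open>w\<close> actually played shows that the board was not yet
        full, so a legal good reply exists.\<close>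
      then obtain w' where "w' \<in> vertices G - set h1" "breaker_holds (live_edges G (h' @ [v, w']))"
        using breaker_holds_legal_reply[OF sub _ h'(1)] w(1,2) unfolding h1 by blast
      then have "good h1 w'"
        unfolding good_def h1 by simp
      then have "good h1 (s h1)"
        by (rule good_s[OF exI])
      then show ?thesis
        unfolding snoc w(3) good_def by blast
    qed
  qed
  have "winning_strategy G Maker Breaker s"
    unfolding winning_strategy_def legal_strategy_def
  proof (intro conjI allI impI)
    fix h :: "'a list"
    assume "position G Maker h \<and> \<not> game_over G Maker h \<and> turn Maker (length h) = Breaker"
    then show "s h \<in> vertices G - set h"
      unfolding position_def game_over_def by (intro s_legal) blast
  next
    fix h :: "'a list"
    assume "position G Maker h \<and> game_over G Maker h \<and> follows Maker Breaker s h"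
    then have h: "distinct h" "set h \<subseteq> vertices G" "follows Maker Breaker s h"
      unfolding position_def by blast+
    have "{} \<notin> live_edges G h"
    proof (cases "even (length h)")
      case True
      then show ?thesis
        using breaker_holds_no_empty[OF even_holds[OF _ h]] by simp
    next
      case False
      then have "h \<noteq> []"
        by auto
      then obtain h' v where h_eq: "h = h' @ [v]"
        using rev_exhaust by blast
      with False have h': "h = h' @ [v]" "even (length h')"
        by simp_all
      then have "breaker_holds (live_edges G h')"
        using h by (intro even_holds) (simp_all add: follows_snoc)
      then obtain w where w: "breaker_holds (residual v w (live_edges G h'))"
        using breaker_holds_reply[of "live_edges G h'" v] by blast
      \<comment> \<open>An edge just completed by Maker would be empty, hence would contain no
        \<open>w\<close> and survive in the residual.\<close>
      then have "{} \<notin> (\<lambda>e. e - {v}) ` live_edges G h'"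
        using breaker_holds_no_empty[OF w] unfolding residual_def by simp
      then show ?thesis
        unfolding h'(1) live_edges_snoc_Maker[OF h'(2)] .
    qed
    then show "winner G Maker h = Breaker"
      using maker_won_live_edges[OF h(1), of G] by (auto simp: winner_def)
  qed
  then show ?thesis
    unfolding wins_def by blast
qed

theorem proposition6: "wins Breaker G_CP Maker"
  using breaker_holds_imp_wins breaker_holds_G_CP finite_hypergraph_G_CP
  unfolding finite_hypergraph_def by blast

end
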